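(* Let $p$ be a prime. If $\phi,\psi\in C(\mathbb{Z}_p,\mathbb{C}_p)$, then $\mathscr{I}(\phi\star\psi) = \mathscr{I}(\phi)\diamond\mathscr{I}(\psi)$.
   Context: $C(\mathbb{Z}_p,\mathbb{C}_p)$ is the $\mathbb{C}_p$-vector space of continuous functions $\mathbb{Z}_p \to \mathbb{C}_p$, and $\mathscr{S}$ is the $\mathbb{C}_p$-linear automorphism of it given by $\mathscr{S}(\phi)(x) = \phi(x) - x\phi(x-1)$. For $n\ge0$, $\beta_n(x) = \binom{x}{n}$; every $\phi \in C(\mathbb{Z}_p,\mathbb{C}_p)$ is uniquely $\sum_{n\ge0}a_n\beta_n$ with $a_n \in \mathbb{C}_p$, $a_n\to0$ (Mahler coefficients). The product $\star$ is $\phi\star\psi = \sum_{n\ge0}\big(\sum_{k=0}^n\binom{n}{k}a_kb_{n-k}\big)\beta_n$, where $(a_k),(b_l)$ are the Mahler coefficients of $\phi,\psi$. The map $\mathscr{I}$ on $C(\mathbb{Z}_p,\mathbb{C}_p)$ is $\mathscr{I}(\psi)(s) = \sum_{n=0}^\infty n!\,\psi(-1-n)\binom{s}{n}$ for $s\in\mathbb{Z}_p$. Let $q = \mathscr{S}^{-1}(\mathbf{1})$ with $\mathbf{1}$ the constant function $1$, so $q(x) = \sum_{n\ge0}n!\binom{x}{n}$. Every element of the image $\operatorname{Im}(\mathscr{I})$ can be written uniquely as $\sum_{n\ge0}b_n\mathscr{S}^{-n}(q)$ with $b_n\in\mathbb{C}_p$, $b_n\to0$, and all such series lie in $\operatorname{Im}(\mathscr{I})$.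 The product $\diamond$ on $\operatorname{Im}(\mathscr{I})$ is defined by $$\left(\sum_{k=0}^\infty b_k\mathscr{S}^{-k}(q)\right)\diamond\left(\sum_{l=0}^\infty c_l\mathscr{S}^{-l}(q)\right) = \sum_{n=0}^\infty\left(\sum_{k=0}^n\binom{n}{k}b_kc_{n-k}\right)\mathscr{S}^{-n}(q) .$$ *)

theory Defs
  imports
    "HOL-Analysis.Analysis"
    "HOL-Computational_Algebra.Computational_Algebra"
    "HOL-Number_Theory.Cong"
    "HOL-Library.FuncSet"
begin

text \<open>
  The libraries have no p-adic numbers. \<open>\<complex>\<^sub>p\<close> is therefore given as a structure: a type carrying
  a field and a complete metric that is a completion of an algebraic closure of \<open>\<rat>\<^sub>p\<close>. This
  determines it up to isometric isomorphism. Inside such a field, \<open>\<rat>\<^sub>p\<close> and \<open>\<int>\<^sub>p\<close> are the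
  completions of \<open>\<rat>\<close> and \<open>\<int>\<close>, that is, their topological closures.
\<close>

definition Qp :: "'c::{field_char_0, metric_space} set" where
  "Qp = closure \<rat>"

definition Zp :: "'c::{field_char_0, metric_space} set" where
  "Zp = closure \<int>"

definition Qp_alg :: "'c::{field_char_0, metric_space} set" where
  "Qp_alg = {x. \<exists>P. P \<noteq> 0 \<and> (\<forall>i. coeff P i \<in> Qp) \<and> poly P x = 0}"

locale padic_complex_field =
  fixes p :: nat and vabs :: "'c::{field_char_0, complete_space} \<Rightarrow> real"
  assumes prime_p: "prime p"
    and dist_vabs: "dist x y = vabs (x - y)"
    and vabs_mult: "vabs (x * y) = vabs x * vabs y"
    and vabs_add: "vabs (x + y) \<le> max (vabs x) (vabs y)"
    and vabs_of_int: "n \<noteq> 0 \<Longrightarrow> vabs (of_int n) = 1 / real p ^ multiplicity (int p) n"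
    and Qp_alg_closed:
      "\<And>P :: 'c poly. degree P > 0 \<Longrightarrow> (\<And>i. coeff P i \<in> Qp_alg) \<Longrightarrow> \<exists>x\<in>Qp_alg. poly P x = 0"
    and Qp_alg_dense: "closure Qp_alg = (UNIV :: 'c set)"
begin

lemma vabs_0 [simp]: "vabs 0 = 0"
  using dist_vabs[of 0 0] by simp

lemma vabs_nonneg [simp]: "vabs x \<ge> 0"
  using dist_vabs[of x 0] by (metis diff_zero zero_le_dist)

lemma vabs_eq_0_iff [simp]: "vabs x = 0 \<longleftrightarrow> x = 0"
  using dist_vabs[of x 0] by (metis diff_zero dist_eq_0_iff)

lemma vabs_minus_commute: "vabs (x - y) = vabs (y - x)"
  by (metis dist_commute dist_vabs)

lemma vabs_of_int_le_1: "vabs (of_int n) \<le> 1"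
proof (cases "n = 0")
  case False
  have "1 \<le> real p ^ multiplicity (int p) n"
    using prime_p prime_ge_1_nat by (intro one_le_power) auto
  then show ?thesis using False prime_gt_0_nat[OF prime_p] by (simp add: vabs_of_int divide_le_eq_1)
qed simp

text \<open>Consistency check: \<open>Zp\<close> is also the valuation ring of \<open>Qp\<close>.\<close>

lemma Zp_eq_unit_ball: "Zp = {x \<in> Qp. vabs x \<le> 1}"
proof (intro equalityI subsetI)
  fix x :: 'c assume x: "x \<in> Zp"
  have "x \<in> Qp" using x closure_mono[OF Ints_subset_Rats] unfolding Zp_def Qp_def by blast
  obtain z where z: "z \<in> \<int>" "dist z x < 1"
    using x unfolding Zp_def closure_approachable by (meson zero_less_one)
  have "vabs x \<le> max (vabs (x - z)) (vabs z)" using vabs_add[of "x - z" z] by simp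
  also have "\<dots> \<le> 1"
    using z vabs_of_int_le_1 by (auto simp: dist_vabs vabs_minus_commute[of x] elim!: Ints_cases)
  finally show "x \<in> {x \<in> Qp. vabs x \<le> 1}" using \<open>x \<in> Qp\<close> by simp
next
  fix x :: 'c assume "x \<in> {x \<in> Qp. vabs x \<le> 1}"
  then have x: "x \<in> closure \<rat>" "vabs x \<le> 1" by (auto simp: Qp_def)
  have p2: "real p > 1" using prime_p prime_gt_1_nat by auto
  have "\<exists>y\<in>\<int>. dist y x < e" if e: "e > 0" for e
  proof -
    obtain r where r: "r \<in> \<rat>" "dist r x < min e 1"
      using x(1) e unfolding closure_approachable by (meson min_less_iff_conj zero_less_one)
    have r1: "vabs r \<le> 1"
      using vabs_add[of "r - x" x] x(2) r(2) unfolding dist_vabs by (auto simp: max_def split: if_splits)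
    obtain a b where b: "b > 0" and ab: "coprime a b" and rab: "r = of_int a / of_int b"
      using r(1) by (rule Rats_cases')
    have b0: "(of_int b :: 'c) \<noteq> 0" using b by simp
    have pa: "prime (int p)" using prime_p by simp
    have npb: "\<not> int p dvd b"
    proof
      assume d: "int p dvd b"
      then have "\<not> int p dvd a"
        using ab pa by (metis coprime_common_divisor not_prime_unit)
      then have va: "vabs (of_int a) = 1"
        using vabs_of_int[of a] by (cases "a = 0") (auto simp: not_dvd_imp_multiplicity_0)
      have "multiplicity (int p) b \<ge> 1"
        using d b pa by (intro multiplicity_geI) (auto dest: not_prime_unit)
      then have "vabs (of_int b) < 1"
        using vabs_of_int[of b] b p2 by (simp add: one_less_power)
      moreover have "vabs r * vabs (of_int b) = vabs (of_int a)"
        using b0 by (simp add: rab flip: vabs_mult)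
      ultimately show False using va r1
        by (smt (verit) mult_left_le_one_le vabs_nonneg)
    qed
    have vb: "vabs (of_int b) = 1"
      using vabs_of_int[of b] b npb by (simp add: not_dvd_imp_multiplicity_0)
    obtain m where m: "(1 / real p) ^ m < e"
      using real_arch_pow_inv[of e "1 / real p"] e p2 by auto
    have "coprime b (int p ^ m)"
      using npb pa by (metis coprime_commute coprime_power_right_iff prime_imp_coprime)
    then obtain c where c: "[b * c = 1] (mod (int p ^ m))"
      using cong_solve_coprime_int by blast
    define d where "d = a - b * (a * c)"
    have "int p ^ m dvd 1 - b * c"
      using c by (metis cong_iff_dvd_diff cong_sym)
    moreover have "d = a * (1 - b * c)" by (simp add: d_def algebra_simps)
    ultimately have dv: "int p ^ m dvd d" by simp
    have vd: "vabs (of_int d) < e"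
    proof (cases "d = 0")
      case False
      have "m \<le> multiplicity (int p) d"
        using dv False pa by (intro multiplicity_geI) auto
      then have "real p ^ m \<le> real p ^ multiplicity (int p) d"
        using p2 by (intro power_increasing) auto
      then have "vabs (of_int d) \<le> 1 / real p ^ m"
        using False p2 by (simp add: vabs_of_int frac_le)
      then show ?thesis using m by (simp add: power_one_over)
    qed (use e in simp)
    have "r - of_int (a * c) = of_int d / of_int b"
      using b0 by (simp add: rab d_def field_simps)
    then have "vabs (r - of_int (a * c)) * vabs (of_int b) = vabs (of_int d)"
      using b0 by (simp flip: vabs_mult)
    then have 1: "vabs (of_int (a * c) - r) < e"
      using vd vb by (simp add: vabs_minus_commute[of _ r])
    have "dist (of_int (a * c)) x \<le> max (vabs (of_int (a * c) - r)) (vabs (r - x))"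
      using vabs_add[of "of_int (a * c) - r" "r - x"] by (simp add: dist_vabs)
    also have "\<dots> < e" using 1 r(2) by (simp add: dist_vabs)
    finally show ?thesis using Ints_of_int by blast
  qed
  then show "x \<in> Zp" unfolding Zp_def closure_approachable by blast
qed

end

text \<open>
  Functions on \<open>\<int>\<^sub>p\<close> are extensional (\<open>undefined\<close> off \<open>Zp\<close>), so that equality of functions is
  equality on \<open>\<int>\<^sub>p\<close>.
\<close>

definition C_Zp :: "('c::{field_char_0, metric_space} \<Rightarrow> 'c) set" where
  "C_Zp = {\<phi> \<in> extensional Zp. continuous_on Zp \<phi>}"

text \<open>
  \<open>\<phi> = (\<Sum>n. a n * e n)\<close> in the Banach space of continuous functions with the supremum norm,
  with coefficients tending to \<open>0\<close>.
\<close>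

definition expands ::
  "(nat \<Rightarrow> 'c::{field_char_0, metric_space} \<Rightarrow> 'c) \<Rightarrow> (nat \<Rightarrow> 'c) \<Rightarrow> ('c \<Rightarrow> 'c) \<Rightarrow> bool" where
  "expands e a \<phi> \<longleftrightarrow>
     a \<longlonglongrightarrow> 0 \<and> uniform_limit Zp (\<lambda>N x. \<Sum>n<N. a n * e n x) \<phi> sequentially"

definition binom_fun :: "nat \<Rightarrow> 'c::{field_char_0, metric_space} \<Rightarrow> 'c" where
  "binom_fun n = (\<lambda>x\<in>Zp. x gchoose n)"

definition mahler_coeffs :: "('c::{field_char_0, metric_space} \<Rightarrow> 'c) \<Rightarrow> nat \<Rightarrow> 'c" where
  "mahler_coeffs \<phi> = (THE a. expands binom_fun a \<phi>)"

definition binomial_conv :: "(nat \<Rightarrow> 'c::field_char_0) \<Rightarrow> (nat \<Rightarrow> 'c) \<Rightarrow> nat \<Rightarrow> 'c" where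
  "binomial_conv a b n = (\<Sum>k\<le>n. of_nat (n choose k) * a k * b (n - k))"

definition star :: "('c::{field_char_0, metric_space} \<Rightarrow> 'c) \<Rightarrow> ('c \<Rightarrow> 'c) \<Rightarrow> 'c \<Rightarrow> 'c"
    (infixl \<open>\<star>\<close> 70) where
  "\<phi> \<star> \<psi> = (\<lambda>x\<in>Zp. \<Sum>n. binomial_conv (mahler_coeffs \<phi>) (mahler_coeffs \<psi>) n * binom_fun n x)"

definition opS :: "('c::{field_char_0, metric_space} \<Rightarrow> 'c) \<Rightarrow> 'c \<Rightarrow> 'c" where
  "opS \<phi> = (\<lambda>x\<in>Zp. \<phi> x - x * \<phi> (x - 1))"

definition opS_inv :: "('c::{field_char_0, metric_space} \<Rightarrow> 'c) \<Rightarrow> 'c \<Rightarrow> 'c" where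
  "opS_inv = inv_into C_Zp opS"

definition q_fun :: "'c::{field_char_0, metric_space} \<Rightarrow> 'c" where
  "q_fun = opS_inv (\<lambda>x\<in>Zp. 1)"

definition opI :: "('c::{field_char_0, metric_space} \<Rightarrow> 'c) \<Rightarrow> 'c \<Rightarrow> 'c" where
  "opI \<psi> = (\<lambda>s\<in>Zp. \<Sum>n. fact n * \<psi> (- 1 - of_nat n) * (s gchoose n))"

definition Sq_fun :: "nat \<Rightarrow> 'c::{field_char_0, metric_space} \<Rightarrow> 'c" where
  "Sq_fun n = (opS_inv ^^ n) q_fun"

definition Sq_coeffs :: "('c::{field_char_0, metric_space} \<Rightarrow> 'c) \<Rightarrow> nat \<Rightarrow> 'c" where
  "Sq_coeffs f = (THE b. expands Sq_fun b f)"

text \<open>Only meaningful for arguments in \<open>opI ` C_Zp\<close>, where the coefficients exist uniquely.\<close>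

definition diamond :: "('c::{field_char_0, metric_space} \<Rightarrow> 'c) \<Rightarrow> ('c \<Rightarrow> 'c) \<Rightarrow> 'c \<Rightarrow> 'c"
    (infixl \<open>\<diamondop>\<close> 70) where
  "f \<diamondop> g = (\<lambda>x\<in>Zp. \<Sum>n. binomial_conv (Sq_coeffs f) (Sq_coeffs g) n * Sq_fun n x)"

end

theory Submission
  imports Defs
begin

text \<open>
  The operator \<open>\<I>\<close> (\<^const>\<open>opI\<close>) carries the Mahler basis to the basis \<open>\<S>\<^sup>-\<^sup>n(q)\<close>
  up to sign: \<open>\<I>(\<beta>\<^sub>m) = (-1)\<^sup>m \<S>\<^sup>-\<^sup>m(q)\<close>. Indeed
  \<open>x \<cdot> n! \<cdot> binom(x - 1, n) = (n + 1)! \<cdot> binom(x, n + 1)\<close>, so subtracting \<open>x \<I>(\<phi>)(x - 1)\<close> from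
  \<open>\<I>(\<phi>)(x)\<close> takes differences of the values \<open>\<phi>(-1), \<phi>(-2), \<dots>\<close>; the difference of \<open>\<beta>\<^sub>m\<close> is
  \<open>\<beta>\<^sub>m\<^sub>-\<^sub>1\<close> by Pascal's rule. Hence \<open>\<S>(\<I>(\<beta>\<^sub>0)) = 1\<close> and \<open>\<S>(\<I>(\<beta>\<^sub>m)) = - \<I>(\<beta>\<^sub>m\<^sub>-\<^sub>1)\<close>, and \<open>\<S>\<close> is
  injective (\<open>Sq_fun_eq\<close>).

  Since \<open>\<I>\<close> does not increase the supremum norm, \<open>\<phi> = \<Sum> a\<^sub>n \<beta>\<^sub>n\<close> gives
  \<open>\<I>(\<phi>) = \<Sum> (-1)\<^sup>n a\<^sub>n \<S>\<^sup>-\<^sup>n(q)\<close> (\<open>expands_Sq_opI\<close>). Both products multiply coefficients by the same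
  binomial convolution, and this convolution respects the twist by \<open>(-1)\<^sup>n\<close>, because
  \<open>(-1)\<^sup>k (-1)\<^sup>n\<^sup>-\<^sup>k = (-1)\<^sup>n\<close>. That is the identity.

  For this to speak about coefficients at all, both kinds of expansion must exist and be unique.
  For the binomial functions existence is Mahler's theorem (\<open>mahler\<close>): the finite differences of a
  continuous function tend to \<open>0\<close>, because \<open>p\<close> divides the inner binomial coefficients of
  order \<open>p\<^sup>t\<close> while uniform continuity makes the two outer terms nearly cancel, up to a multiple of \<open>p\<close>. Uniqueness for \<open>\<S>\<^sup>-\<^sup>n(q)\<close> is reduced to
  uniqueness for \<open>\<beta>\<^sub>n\<close> by the injectivity of \<open>\<I>\<close>, which holds because the negative
  integers are dense in \<open>\<int>\<^sub>p\<close>.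
\<close>

section \<open>Finite differences\<close>

definition fdiff :: "(nat \<Rightarrow> 'a::ab_group_add) \<Rightarrow> nat \<Rightarrow> 'a" where
  "fdiff f x = f (Suc x) - f x"

lemma fdiff_funpow_Suc: "(fdiff ^^ Suc n) f x = (fdiff ^^ n) f (Suc x) - (fdiff ^^ n) f x"
  by (simp add: fdiff_def)

text \<open>
  Pascal's rule in summed form, the induction step shared by the two inversion formulas below.
\<close>

lemma sum_binomial_Suc:
  "(\<Sum>n\<le>Suc k. of_nat (Suc k choose n) * (u n :: 'a::comm_ring_1)) =
   (\<Sum>n\<le>k. of_nat (k choose n) * u n) + (\<Sum>n\<le>k. of_nat (k choose n) * u (Suc n))"
proof -
  have "(\<Sum>n\<le>Suc k. of_nat (Suc k choose n) * u n) =
      u 0 + (\<Sum>n\<le>k. of_nat (k choose Suc n) * u (Suc n)) + (\<Sum>n\<le>k. of_nat (k choose n) * u (Suc n))"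
    by (simp add: sum.atMost_Suc_shift sum.distrib algebra_simps del: sum.atMost_Suc)
  also have "u 0 + (\<Sum>n\<le>k. of_nat (k choose Suc n) * u (Suc n)) = (\<Sum>n\<le>Suc k. of_nat (k choose n) * u n)"
    by (simp add: sum.atMost_Suc_shift del: sum.atMost_Suc)
  also have "\<dots> = (\<Sum>n\<le>k. of_nat (k choose n) * u n)" by (simp add: binomial_eq_0)
  finally show ?thesis .
qed

lemma newton_forward:
  fixes f :: "nat \<Rightarrow> 'a::comm_ring_1"
  shows "f (x + k :: nat) = (\<Sum>n\<le>k. of_nat (k choose n) * (fdiff ^^ n) f x)"
proof (induction k arbitrary: x)
  case (Suc k)
  have "f (x + Suc k) = (\<Sum>n\<le>k. of_nat (k choose n) * (fdiff ^^ n) f (Suc x))"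
    using Suc[of "Suc x"] by simp
  also have "\<dots> = (\<Sum>n\<le>k. of_nat (k choose n) * (fdiff ^^ n) f x) +
      (\<Sum>n\<le>k. of_nat (k choose n) * (fdiff ^^ Suc n) f x)"
    unfolding fdiff_funpow_Suc by (simp add: algebra_simps flip: sum.distrib)
  finally show ?case by (simp only: sum_binomial_Suc)
qed simp

lemma fdiff_funpow:
  fixes f :: "nat \<Rightarrow> 'a::comm_ring_1"
  shows "(fdiff ^^ n) f x = (\<Sum>k\<le>n. of_nat (n choose k) * ((-1) ^ (n - k) * f (x + k)))"
proof (induction n arbitrary: x)
  case (Suc n)
  have "(fdiff ^^ Suc n) f x =
      (\<Sum>k\<le>n. of_nat (n choose k) * ((-1) ^ (Suc n - k) * f (x + k))) +
      (\<Sum>k\<le>n. of_nat (n choose k) * ((-1) ^ (Suc n - Suc k) * f (x + Suc k)))"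
    unfolding fdiff_funpow_Suc by (simp add: Suc Suc_diff_le sum_negf)
  then show ?case by (simp only: sum_binomial_Suc)
qed simp

lemma fdiff_funpow_shift:
  "(fdiff ^^ n) f (x + d) - (fdiff ^^ n) f x = (fdiff ^^ n) (\<lambda>y. f (y + d) - f y) x"
proof (induction n arbitrary: x)
  case (Suc n)
  show ?case unfolding fdiff_funpow_Suc Suc[symmetric] by simp
qed simp

context padic_complex_field
begin

section \<open>Limits and series in an ultrametric field\<close>

lemma vabs_minus [simp]: "vabs (- x) = vabs x"
  using vabs_minus_commute[of 0 x] by simp

lemma vabs_1 [simp]: "vabs 1 = 1"
  using vabs_of_int[of 1] by simp

lemma vabs_power: "vabs (x ^ n) = vabs x ^ n"
  by (induction n) (simp_all add: vabs_mult)

lemma vabs_neg_one_power_mult [simp]: "vabs ((-1) ^ n * x) = vabs x"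
  by (simp add: vabs_mult vabs_power)

lemma vabs_diff: "vabs (x - y) \<le> max (vabs x) (vabs y)"
  using vabs_add[of x "- y"] by simp

lemma vabs_of_nat_le_1: "vabs (of_nat n) \<le> 1"
  using vabs_of_int_le_1[of "int n"] by simp

lemma vabs_sum_le:
  assumes "\<And>i. i \<in> A \<Longrightarrow> vabs (f i) \<le> B" and "0 \<le> B"
  shows "vabs (sum f A) \<le> B"
  using assms
proof (induction A rule: infinite_finite_induct)
  case (insert i A)
  then have "vabs (f i) \<le> B" "vabs (sum f A) \<le> B" by simp_all
  then show ?case
    using insert(1,2) vabs_add[of "f i" "sum f A"] by simp
qed simp_all

lemma tendsto_vabs_iff: "(f \<longlongrightarrow> l) F \<longleftrightarrow> ((\<lambda>x. vabs (f x - l)) \<longlongrightarrow> 0) F"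
  unfolding dist_vabs[symmetric] by (rule tendsto_dist_iff)

lemma tendsto_0_vabs_le:
  assumes "(g \<longlongrightarrow> 0) F" and "\<And>x. vabs (f x - l) \<le> g x"
  shows "(f \<longlongrightarrow> l) F"
  unfolding tendsto_vabs_iff
  by (rule tendsto_sandwich[OF _ _ tendsto_const assms(1)]) (simp_all add: assms(2))

text \<open>
  The type of scalars carries only a field structure and a metric, so continuity of the ring
  operations has to be derived from the absolute value.
\<close>

lemma tendsto_vabs_add:
  fixes a b :: 'c
  assumes "(f \<longlongrightarrow> a) F" and "(g \<longlongrightarrow> b) F"
  shows "((\<lambda>x. f x + g x) \<longlongrightarrow> a + b) F"
proof (rule tendsto_0_vabs_le)
  show "((\<lambda>x. vabs (f x - a) + vabs (g x - b)) \<longlongrightarrow> 0) F"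
    using tendsto_add[OF assms[unfolded tendsto_vabs_iff]] by simp
  show "vabs (f x + g x - (a + b)) \<le> vabs (f x - a) + vabs (g x - b)" for x
    using vabs_add[of "f x - a" "g x - b"] vabs_nonneg[of "f x - a"] vabs_nonneg[of "g x - b"]
    by (simp add: algebra_simps del: vabs_nonneg)
qed

lemma tendsto_vabs_mult:
  fixes a b :: 'c
  assumes "(f \<longlongrightarrow> a) F" and "(g \<longlongrightarrow> b) F"
  shows "((\<lambda>x. f x * g x) \<longlongrightarrow> a * b) F"
proof (rule tendsto_0_vabs_le)
  let ?u = "\<lambda>x. vabs (f x - a)" and ?v = "\<lambda>x. vabs (g x - b)"
  have "((\<lambda>x. ?u x * ?v x + vabs a * ?v x + ?u x * vabs b) \<longlongrightarrow> 0 * 0 + vabs a * 0 + 0 * vabs b) F"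
    using assms unfolding tendsto_vabs_iff by (intro tendsto_intros)
  then show "((\<lambda>x. ?u x * ?v x + vabs a * ?v x + ?u x * vabs b) \<longlongrightarrow> 0) F"
    by simp
  show "vabs (f x * g x - a * b) \<le> ?u x * ?v x + vabs a * ?v x + ?u x * vabs b" for x
  proof -
    have "f x * g x - a * b = (f x - a) * (g x - b) + (a * (g x - b) + (f x - a) * b)"
      by (simp add: algebra_simps)
    moreover have "vabs (r + (s + t)) \<le> vabs r + vabs s + vabs t" for r s t
      using vabs_add[of r "s + t"] vabs_add[of s t]
        vabs_nonneg[of r] vabs_nonneg[of s] vabs_nonneg[of t] by linarith
    ultimately show ?thesis by (metis vabs_mult)
  qed
qed

lemma tendsto_vabs_diff: "(f \<longlongrightarrow> (a :: 'c)) F \<Longrightarrow> (g \<longlongrightarrow> b) F \<Longrightarrow> ((\<lambda>x. f x - g x) \<longlongrightarrow> a - b) F"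
  using tendsto_vabs_add[OF _ tendsto_vabs_mult[OF tendsto_const[of "-1"]], of f a F g b] by simp

lemma sums_vabs_add: "f sums (a :: 'c) \<Longrightarrow> g sums b \<Longrightarrow> (\<lambda>n. f n + g n) sums (a + b)"
  unfolding sums_def sum.distrib by (rule tendsto_vabs_add)

lemma sums_vabs_cmult: "f sums (a :: 'c) \<Longrightarrow> (\<lambda>n. c * f n) sums (c * a)"
  unfolding sums_def sum_distrib_left[symmetric] by (intro tendsto_vabs_mult tendsto_const)

lemma sums_vabs_diff: "f sums (a :: 'c) \<Longrightarrow> g sums b \<Longrightarrow> (\<lambda>n. f n - g n) sums (a - b)"
  unfolding sums_def sum_subtractf by (rule tendsto_vabs_diff)

lemma sums_vabs_sum:
  "(\<And>i. i < (M::nat) \<Longrightarrow> f i sums (a i :: 'c)) \<Longrightarrow> (\<lambda>n. \<Sum>i<M. f i n) sums (\<Sum>i<M. a i)"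
  by (induction M) (auto intro: sums_vabs_add simp: sums_0)

lemma sums_vabs_Suc:
  fixes s :: 'c
  assumes "(\<lambda>n. f (Suc n)) sums s" shows "f sums (f 0 + s)"
proof -
  have "(\<lambda>n. f 0 + (\<Sum>i<n. f (Suc i))) \<longlonglongrightarrow> f 0 + s"
    using assms unfolding sums_def by (intro tendsto_vabs_add tendsto_const)
  then have "(\<lambda>n. \<Sum>i<Suc n. f i) \<longlonglongrightarrow> f 0 + s"
    by (simp only: sum.lessThan_Suc_shift)
  then show ?thesis unfolding sums_def by (rule LIMSEQ_imp_Suc)
qed

lemma lim_vabs_diff_le:
  fixes a b :: 'c
  assumes "X \<longlonglongrightarrow> a" and "Y \<longlonglongrightarrow> b" and "\<And>n. vabs (X n - Y n) \<le> e"
  shows "vabs (a - b) \<le> e"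
proof -
  have "(\<lambda>n. dist (X n) (Y n)) \<longlonglongrightarrow> dist a b"
    using assms(1,2) by (rule tendsto_dist)
  then show ?thesis
    using assms(3) by (intro LIMSEQ_le_const2[of _ "vabs (a - b)" e]) (auto simp: dist_vabs)
qed

text \<open>
  In an ultrametric field a block of terms is no larger than its largest term, so the partial sums of a null sequence are Cauchy.
\<close>

lemma null_imp_summable:
  assumes "c \<longlonglongrightarrow> (0 :: 'c)" shows "summable c"
proof -
  have "Cauchy (\<lambda>n. \<Sum>i<n. c i)"
  proof (rule metric_CauchyI)
    fix e :: real assume e: "e > 0"
    then obtain N where N: "\<And>n. n \<ge> N \<Longrightarrow> vabs (c n) < e / 2"
      using assms unfolding lim_sequentially dist_vabs by (metis diff_zero half_gt_zero)
    have le: "vabs ((\<Sum>i<m. c i) - (\<Sum>i<n. c i)) \<le> e / 2" if "N \<le> n" "n \<le> m" for m n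
    proof -
      have "(\<Sum>i<m. c i) - (\<Sum>i<n. c i) = (\<Sum>i=n..<m. c i)"
        using that by (simp add: sum_diff_nat_ivl lessThan_atLeast0)
      also have "vabs \<dots> \<le> e / 2"
        using N that e by (intro vabs_sum_le) (auto intro: less_imp_le)
      finally show ?thesis .
    qed
    have "dist (\<Sum>i<m. c i) (\<Sum>i<n. c i) < e" if "m \<ge> N" "n \<ge> N" for m n
      using le[of n m] le[of m n] that e vabs_minus_commute[of "\<Sum>i<m. c i"]
      unfolding dist_vabs by (cases "n \<le> m") auto
    then show "\<exists>M. \<forall>m\<ge>M. \<forall>n\<ge>M. dist (\<Sum>i<m. c i) (\<Sum>i<n. c i) < e" by blast
  qed
  then show ?thesis
    unfolding summable_iff_convergent by (rule Cauchy_convergent)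
qed

text \<open>
  The ultrametric bound on the tail depends only on the coefficients, which makes the convergence uniform on \<open>\<int>\<^sub>p\<close>.
\<close>

lemma expands_suminf:
  assumes a: "a \<longlonglongrightarrow> 0" and e: "\<And>n (x :: 'c). x \<in> Zp \<Longrightarrow> vabs (e n x) \<le> 1"
  shows "expands e a (\<lambda>x\<in>Zp. \<Sum>n. a n * e n x)"
  unfolding expands_def
proof (intro conjI a uniform_limitI)
  fix \<epsilon> :: real assume \<epsilon>: "\<epsilon> > 0"
  then obtain N where N: "\<And>n. n \<ge> N \<Longrightarrow> vabs (a n) < \<epsilon> / 2"
    using a unfolding lim_sequentially dist_vabs by (metis diff_zero half_gt_zero)
  have "dist (\<Sum>n<M. a n * e n x) (\<Sum>n. a n * e n x) < \<epsilon>" if M: "M \<ge> N" and x: "x \<in> Zp" for M x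
  proof -
    have ae: "vabs (a n * e n x) \<le> vabs (a n)" for n
      using e[OF x, of n] by (simp add: vabs_mult mult_left_le)
    have "(\<lambda>n. a n * e n x) \<longlonglongrightarrow> 0"
      using a ae unfolding tendsto_vabs_iff[of a] by (intro tendsto_0_vabs_le) auto
    then have lim: "(\<lambda>k. \<Sum>n<k. a n * e n x) \<longlonglongrightarrow> (\<Sum>n. a n * e n x)"
      by (intro summable_LIMSEQ null_imp_summable)
    have "vabs ((\<Sum>n<k + M. a n * e n x) - (\<Sum>n<M. a n * e n x)) \<le> \<epsilon> / 2" for k
    proof -
      have "(\<Sum>n<k + M. a n * e n x) - (\<Sum>n<M. a n * e n x) = (\<Sum>n=M..<k + M. a n * e n x)"
        by (simp add: sum_diff_nat_ivl lessThan_atLeast0)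
      also have "vabs \<dots> \<le> \<epsilon> / 2"
        using N M \<epsilon> by (intro vabs_sum_le order_trans[OF ae]) (auto intro: less_imp_le)
      finally show ?thesis .
    qed
    then have "vabs ((\<Sum>n. a n * e n x) - (\<Sum>n<M. a n * e n x)) \<le> \<epsilon> / 2"
      using LIMSEQ_ignore_initial_segment[OF lim, of M] by (rule lim_vabs_diff_le[OF _ tendsto_const, rotated])
    then show ?thesis using \<epsilon> by (simp add: dist_vabs vabs_minus_commute)
  qed
  then show "\<forall>\<^sub>F M in sequentially. \<forall>x\<in>Zp. dist (\<Sum>n<M. a n * e n x) ((\<lambda>x\<in>Zp. \<Sum>n. a n * e n x) x) < \<epsilon>"
    by (auto simp: eventually_sequentially)
qed

lemma expands_sums: "expands e a (f :: 'c \<Rightarrow> 'c) \<Longrightarrow> x \<in> Zp \<Longrightarrow> (\<lambda>n. a n * e n x) sums f x"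
  unfolding expands_def sums_def by (auto intro: tendsto_uniform_limitI)

lemma expands_eq_suminf:
  "expands e a (f :: 'c \<Rightarrow> 'c) \<Longrightarrow> f \<in> extensional Zp \<Longrightarrow> f = (\<lambda>x\<in>Zp. \<Sum>n. a n * e n x)"
  by (rule extensionalityI) (auto dest: expands_sums sums_unique)

section \<open>The ring of p-adic integers\<close>

lemma p_gt_1: "real p > 1"
  using prime_p prime_gt_1_nat by auto

lemma vabs_p_power_mult_le: "vabs (of_nat (p ^ j * k)) \<le> (1 / real p) ^ j"
proof -
  have "vabs (of_nat p) = 1 / real p"
    using vabs_of_int[of "int p"] prime_p by (simp add: prime_gt_0_nat)
  then show ?thesis
    using vabs_of_nat_le_1[of k] p_gt_1 by (simp add: vabs_mult vabs_power mult_left_le)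
qed

lemma exists_p_power_less: "e > 0 \<Longrightarrow> \<exists>j. (1 / real p) ^ j < e"
  using real_arch_pow_inv[of e "1 / real p"] p_gt_1 by auto

text \<open>
  This is what makes \<open>\<I>\<close> converge: \<open>p\<^sup>j\<close> divides \<open>n!\<close> as soon as \<open>n \<ge> p\<^sup>j\<close>.
\<close>

lemma fact_tendsto_0: "(\<lambda>n. fact n :: 'c) \<longlonglongrightarrow> 0"
  unfolding lim_sequentially
proof (intro allI impI)
  fix e :: real assume "e > 0"
  then obtain j where j: "(1 / real p) ^ j < e" using exists_p_power_less by blast
  have "dist (fact n :: 'c) 0 < e" if "n \<ge> p ^ j" for n
  proof -
    have "p ^ j dvd (fact n :: nat)"
      using that prime_p by (intro dvd_fact) (auto simp: prime_gt_0_nat Suc_leI)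
    then obtain k where "(fact n :: nat) = p ^ j * k" by (elim dvdE)
    then have "(fact n :: 'c) = of_nat (p ^ j * k)" by (metis of_nat_fact)
    then show ?thesis using vabs_p_power_mult_le[of j k] j by (simp add: dist_vabs)
  qed
  then show "\<exists>N. \<forall>n\<ge>N. dist (fact n :: 'c) 0 < e" by blast
qed

lemma of_int_in_Zp [simp]: "(of_int z :: 'c) \<in> Zp"
  unfolding Zp_def using closure_subset[of "\<int> :: 'c set"] by auto

lemma of_nat_in_Zp [simp]: "(of_nat n :: 'c) \<in> Zp"
  using of_int_in_Zp[of "int n"] by simp

lemma minus_1_minus_of_nat_in_Zp [simp]: "(- 1 - of_nat n :: 'c) \<in> Zp"
  using of_int_in_Zp[of "- 1 - int n"] by simp

lemma of_int_minus_in_Zp: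
  fixes x :: 'c
  assumes "x \<in> Zp" shows "of_int z - x \<in> Zp"
  unfolding Zp_def closure_approachable
proof (intro allI impI)
  fix e :: real assume "e > 0"
  then obtain y where y: "y \<in> \<int>" "dist y x < e"
    using assms unfolding Zp_def closure_approachable by blast
  have "dist (of_int z - y) (of_int z - x) = dist y x"
    using vabs_minus_commute[of x y] by (simp add: dist_vabs)
  with y show "\<exists>w\<in>\<int>. dist w (of_int z - x) < e"
    by (intro bexI[of _ "of_int z - y"]) auto
qed

lemma diff_1_in_Zp: "(x :: 'c) \<in> Zp \<Longrightarrow> x - 1 \<in> Zp"
  using of_int_minus_in_Zp[OF of_int_minus_in_Zp[of x 1], of 0] by simp

text \<open>
  An integer \<open>z\<close> is close to the natural number \<open>z + p\<^sup>j \<bar>z\<bar>\<close> for large \<open>j\<close>.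
\<close>

lemma nat_dense_in_Zp:
  fixes x :: 'c
  assumes x: "x \<in> Zp" and e: "e > 0"
  shows "\<exists>k. dist (of_nat k) x < e"
proof -
  obtain z where z: "dist (of_int z) x < e"
    using x e unfolding Zp_def closure_approachable by (auto elim!: Ints_cases)
  obtain j where j: "(1 / real p) ^ j < e" using exists_p_power_less e by blast
  define k where "k = nat (z + int (p ^ j * nat \<bar>z\<bar>))"
  have "1 \<le> p ^ j" using prime_gt_0_nat[OF prime_p] by simp
  then have "1 \<le> int (p ^ j)" by linarith
  then have "\<bar>z\<bar> \<le> int (p ^ j) * \<bar>z\<bar>"
    using mult_right_mono[of 1 "int (p ^ j)" "\<bar>z\<bar>"] by simp
  then have "int k = z + int (p ^ j * nat \<bar>z\<bar>)"
    unfolding k_def by simp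
  then have "of_int (int k) = of_int z + (of_nat (p ^ j * nat \<bar>z\<bar>) :: 'c)"
    by (metis of_int_add of_int_of_nat_eq)
  then have "of_nat k - x = of_nat (p ^ j * nat \<bar>z\<bar>) + (of_int z - x)" by simp
  then have "dist (of_nat k) x \<le> max (vabs (of_nat (p ^ j * nat \<bar>z\<bar>))) (dist (of_int z) x)"
    using vabs_add by (simp only: dist_vabs)
  also have "\<dots> < e"
    using le_less_trans[OF vabs_p_power_mult_le j] z by (simp only: max_less_iff_conj simp_thms)
  finally have "dist (of_nat k) x < e" .
  then show ?thesis by blast
qed

lemma Zp_limit_of_nats:
  fixes x :: 'c
  assumes "x \<in> Zp" obtains k where "(\<lambda>n. of_nat (k n)) \<longlonglongrightarrow> x"
proof -
  obtain k where k: "\<And>n. dist (of_nat (k n)) x < 1 / real (Suc n)"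
    using choice[of "\<lambda>n k. dist (of_nat k) x < 1 / real (Suc n)"]
      nat_dense_in_Zp[OF assms, of "1 / real (Suc _)"] by auto
  have "(\<lambda>n. of_nat (k n)) \<longlonglongrightarrow> x"
    using k by (intro tendsto_0_vabs_le[OF lim_1_over_n[THEN LIMSEQ_Suc]]) (simp add: dist_vabs less_imp_le)
  then show ?thesis using that by blast
qed

lemma continuous_on_Zp_eqI:
  fixes f g :: "'c \<Rightarrow> 'c"
  assumes f: "continuous_on Zp f" and g: "continuous_on Zp g"
    and eq: "\<And>n. f (of_nat n) = g (of_nat n)" and x: "x \<in> Zp"
  shows "f x = g x"
proof -
  obtain k where k: "(\<lambda>n. of_nat (k n)) \<longlonglongrightarrow> x" using Zp_limit_of_nats[OF x] .
  have "(\<lambda>n. f (of_nat (k n))) \<longlonglongrightarrow> f x" "(\<lambda>n. f (of_nat (k n))) \<longlonglongrightarrow> g x"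
    using continuous_on_tendsto_compose[OF f k x] continuous_on_tendsto_compose[OF g k x]
    by (simp_all add: eq)
  then show ?thesis by (rule LIMSEQ_unique)
qed

lemma C_Zp_eqI:
  fixes f g :: "'c \<Rightarrow> 'c"
  assumes "f \<in> C_Zp" and "g \<in> C_Zp" and "\<And>n. f (of_nat n) = g (of_nat n)"
  shows "f = g"
proof (rule extensionalityI[of f Zp g])
  show "f x = g x" if "x \<in> Zp" for x
    by (rule continuous_on_Zp_eqI) (use assms that in \<open>auto simp: C_Zp_def\<close>)
qed (use assms in \<open>auto simp: C_Zp_def\<close>)

text \<open>
  The residues \<open>0, \<dots>, p\<^sup>j - 1\<close> form a finite net of radius \<open>p\<^sup>-\<^sup>j\<close>.
\<close>

lemma compact_Zp: "compact (Zp :: 'c set)"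
  unfolding compact_eq_totally_bounded
proof (intro conjI allI impI)
  show "complete (Zp :: 'c set)" by (simp add: complete_eq_closed Zp_def)
  fix e :: real assume e: "e > 0"
  then obtain j where j: "(1 / real p) ^ j < e" using exists_p_power_less by blast
  have "\<exists>r<p ^ j. dist (of_nat r) x < e" if x: "x \<in> Zp" for x :: 'c
  proof -
    obtain k where k: "dist (of_nat k) x < e" using nat_dense_in_Zp[OF x e] by blast
    \<comment> \<open>Reducing modulo \<open>p\<^sup>j\<close> moves the approximation by less than \<open>e\<close>.\<close>
    have "(of_nat k :: 'c) = of_nat (k mod p ^ j) + of_nat (p ^ j * (k div p ^ j))"
      by (metis mod_mult_div_eq of_nat_add)
    then have "of_nat (k mod p ^ j) - x = of_nat k - x - of_nat (p ^ j * (k div p ^ j))"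
      by simp
    then have "dist (of_nat (k mod p ^ j)) x \<le>
        max (dist (of_nat k) x) (vabs (of_nat (p ^ j * (k div p ^ j))))"
      using vabs_diff by (simp only: dist_vabs)
    also have "\<dots> < e"
      using le_less_trans[OF vabs_p_power_mult_le j] k by (simp only: max_less_iff_conj simp_thms)
    finally have "dist (of_nat (k mod p ^ j)) x < e" .
    moreover have "k mod p ^ j < p ^ j" using prime_gt_0_nat[OF prime_p] by simp
    ultimately show ?thesis by blast
  qed
  then show "\<exists>k. finite k \<and> (Zp :: 'c set) \<subseteq> (\<Union>x\<in>k. ball x e)"
    by (intro exI[of _ "of_nat ` {..<p ^ j}"]) fastforce
qed

lemma C_Zp_bounded:
  assumes "\<phi> \<in> C_Zp" obtains B where "\<And>x :: 'c. x \<in> Zp \<Longrightarrow> vabs (\<phi> x :: 'c) \<le> B"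
proof -
  have "bounded (\<phi> ` Zp)"
    using assms by (intro compact_imp_bounded compact_continuous_image compact_Zp) (simp add: C_Zp_def)
  then show ?thesis
    using that unfolding bounded_any_center[of _ 0] by (auto simp: dist_vabs)
qed

section \<open>Binomial functions and uniqueness of Mahler coefficients\<close>

lemma tendsto_gchoose: "(f \<longlongrightarrow> (a :: 'c)) F \<Longrightarrow> ((\<lambda>x. f x gchoose n) \<longlongrightarrow> a gchoose n) F"
proof -
  assume f: "(f \<longlongrightarrow> a) F"
  have "((\<lambda>x. \<Prod>i=0..<n. f x - of_nat i) \<longlongrightarrow> (\<Prod>i=0..<n. a - of_nat i)) F"
    by (induction n) (auto intro!: tendsto_vabs_mult tendsto_vabs_diff f tendsto_const)
  then have "((\<lambda>x. inverse (fact n) * (\<Prod>i=0..<n. f x - of_nat i)) \<longlongrightarrow>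
      inverse (fact n) * (\<Prod>i=0..<n. a - of_nat i)) F"
    by (intro tendsto_vabs_mult tendsto_const)
  then show ?thesis by (simp add: gbinomial_prod_rev field_simps)
qed

text \<open>
  Binomial polynomials take integer values on the natural numbers; the bound passes to the closure by continuity.
\<close>

lemma vabs_gchoose_le_1: "x \<in> Zp \<Longrightarrow> vabs (x gchoose n) \<le> 1"
proof -
  assume "x \<in> Zp"
  then obtain k where k: "(\<lambda>i. of_nat (k i)) \<longlonglongrightarrow> x" by (rule Zp_limit_of_nats)
  have "vabs ((x gchoose n) - 0) \<le> 1"
    by (rule lim_vabs_diff_le[OF tendsto_gchoose[OF k] tendsto_const])
      (simp add: vabs_of_nat_le_1 flip: binomial_gbinomial)
  then show ?thesis by simp
qed

lemma vabs_binom_fun_le_1: "x \<in> Zp \<Longrightarrow> vabs (binom_fun n x) \<le> 1"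
  by (simp add: binom_fun_def vabs_gchoose_le_1)

lemma binom_fun_of_nat: "binom_fun n (of_nat k :: 'c) = of_nat (k choose n)"
  by (simp add: binom_fun_def binomial_gbinomial)

lemma binom_fun_in_C_Zp: "(binom_fun n :: 'c \<Rightarrow> 'c) \<in> C_Zp"
proof -
  have "continuous_on Zp (\<lambda>x::'c. x gchoose n)"
    unfolding continuous_on_def by (auto intro: tendsto_gchoose tendsto_ident_at)
  then show ?thesis
    unfolding C_Zp_def binom_fun_def by (auto cong: continuous_on_cong)
qed

lemma continuous_on_sum_Zp:
  fixes e :: "nat \<Rightarrow> 'c \<Rightarrow> 'c"
  assumes "\<And>n. n < (N::nat) \<Longrightarrow> continuous_on Zp (e n)"
  shows "continuous_on Zp (\<lambda>x. \<Sum>n<N. a n * e n x)"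
  using assms
proof (induction N)
  case (Suc N)
  have "continuous_on Zp (e N)" "continuous_on Zp (\<lambda>x. \<Sum>n<N. a n * e n x)"
    using Suc by auto
  then show ?case
    unfolding continuous_on_def sum.lessThan_Suc by (intro ballI tendsto_vabs_add tendsto_vabs_mult tendsto_const) auto
qed simp

lemma expands_binom_continuous:
  fixes f :: "'c \<Rightarrow> 'c"
  assumes "expands binom_fun a f" shows "continuous_on Zp f"
proof (rule uniform_limit_theorem)
  show "uniform_limit Zp (\<lambda>N x. \<Sum>n<N. a n * binom_fun n x) f sequentially"
    using assms by (simp add: expands_def)
  show "\<forall>\<^sub>F N in sequentially. continuous_on Zp (\<lambda>x. \<Sum>n<N. a n * binom_fun n x)"
    using binom_fun_in_C_Zp by (intro always_eventually allI continuous_on_sum_Zp) (auto simp: C_Zp_def)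
qed simp

lemma expands_binom_of_nat:
  fixes f :: "'c \<Rightarrow> 'c"
  assumes "expands binom_fun a f"
  shows "f (of_nat k) = (\<Sum>n\<le>k. of_nat (k choose n) * a n)"
proof -
  have "(\<lambda>n. of_nat (k choose n) * a n) sums f (of_nat k)"
    using expands_sums[OF assms of_nat_in_Zp[of k]] by (simp add: binom_fun_of_nat mult.commute)
  moreover have "(\<lambda>n. of_nat (k choose n) * a n) sums (\<Sum>n\<le>k. of_nat (k choose n) * a n)"
    by (rule sums_finite) (auto simp: binomial_eq_0)
  ultimately show ?thesis by (rule sums_unique2)
qed

text \<open>
  The values at \<open>0, 1, 2, \<dots>\<close> determine the coefficients through a unitriangular system.
\<close>

lemma expands_binom_unique:
  fixes f :: "'c \<Rightarrow> 'c"
  assumes a: "expands binom_fun a f" and b: "expands binom_fun b f"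
  shows "a = b"
proof
  fix k show "a k = b k"
  proof (induction k rule: less_induct)
    case (less k)
    have "(\<Sum>n\<le>k. of_nat (k choose n) * a n) = (\<Sum>n\<le>k. of_nat (k choose n) * b n)"
      using expands_binom_of_nat[OF a, of k] expands_binom_of_nat[OF b, of k] by simp
    then show ?case
      using less by (simp add: lessThan_Suc_atMost[symmetric])
  qed
qed

section \<open>Mahler's theorem\<close>

lemma vabs_fdiff_funpow_le:
  assumes "\<And>x. vabs (f x) \<le> B" shows "vabs ((fdiff ^^ n) f x) \<le> B"
proof (induction n arbitrary: x)
  case (Suc n)
  then have "max (vabs ((fdiff ^^ n) f (Suc x))) (vabs ((fdiff ^^ n) f x)) \<le> B" by simp
  then show ?case
    unfolding fdiff_funpow_Suc by (rule order_trans[OF vabs_diff])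
qed (simp add: assms)

text \<open>
  For a sequence that is the restriction of a function on \<open>\<int>\<^sub>p\<close> this is what uniform continuity gives. In this
  form, a bound on one fixed shift, the property passes to finite differences.
\<close>

definition padic_uniform :: "(nat \<Rightarrow> 'c) \<Rightarrow> bool" where
  "padic_uniform f \<longleftrightarrow> (\<forall>e>0. \<exists>t. \<forall>x. vabs (f (x + p ^ t) - f x) \<le> e)"

lemma padic_uniform_fdiff_funpow: "padic_uniform f \<Longrightarrow> padic_uniform ((fdiff ^^ n) f)"
  unfolding padic_uniform_def fdiff_funpow_shift by (meson vabs_fdiff_funpow_le)

lemma prime_dvd_prime_power_choose:
  assumes "0 < k" and "k < p ^ t" shows "p dvd p ^ t choose k"
proof (rule ccontr)
  assume "\<not> p dvd p ^ t choose k"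
  then have "coprime (p ^ t) (p ^ t choose k)"
    using prime_p by (simp add: prime_imp_coprime)
  moreover have "k * (p ^ t choose k) = p ^ t * (p ^ t - 1 choose (k - 1))"
    using assms by (intro times_binomial_minus1_eq)
  ultimately have "p ^ t dvd k"
    by (metis coprime_dvd_mult_left_iff dvd_triv_left)
  then show False using assms by (auto dest: dvd_imp_le)
qed

text \<open>
  In the difference of order \<open>n = p\<^sup>t\<close> all inner binomial coefficients are divisible by \<open>p\<close>, which
  costs a factor \<open>1/p\<close>. The two outer terms make up \<open>f(x + n) - f(x)\<close>, small for a suitable \<open>t\<close>; when
  \<open>p = 2\<close> and \<open>n\<close> is even the signs leave an extra \<open>2 f(x)\<close>, again a multiple of \<open>p\<close>.
\<close>

lemma fdiff_funpow_contracts: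
  assumes f: "padic_uniform f" and B: "\<And>x. vabs (f x) \<le> B" "B > 0"
  shows "\<exists>n. \<forall>x. vabs ((fdiff ^^ n) f x) \<le> B / real p"
proof -
  have Bp: "B / real p > 0" using B p_gt_1 by simp
  then obtain t where t: "\<And>x. vabs (f (x + p ^ t) - f x) \<le> B / real p"
    using f unfolding padic_uniform_def by blast
  define n where "n = p ^ t"
  have n: "n > 0" using prime_gt_0_nat[OF prime_p] by (simp add: n_def)
  have p_multiple: "vabs (of_nat (p * m) * f y) \<le> B / real p" for m y
  proof -
    have "vabs (of_nat (p * m) * f y) \<le> (1 / real p) * B"
      unfolding vabs_mult[of _ "f y"]
      using vabs_p_power_mult_le[of 1 m] B by (intro mult_mono) auto
    then show ?thesis by simp
  qed
  have "vabs ((fdiff ^^ n) f x) \<le> B / real p" for x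
  proof -
    let ?g = "\<lambda>k. of_nat (n choose k) * ((-1) ^ (n - k) * f (x + k))"
    have "(fdiff ^^ n) f x = (\<Sum>k\<in>{..n} - {0, n}. ?g k) + (?g 0 + ?g n)"
      using n unfolding fdiff_funpow by (subst sum.subset_diff[of "{0, n}"]) auto
    moreover have "vabs (\<Sum>k\<in>{..n} - {0, n}. ?g k) \<le> B / real p"
    proof (rule vabs_sum_le)
      fix k assume "k \<in> {..n} - {0, n}"
      then have "p dvd n choose k"
        unfolding n_def by (intro prime_dvd_prime_power_choose) auto
      then obtain m where "n choose k = p * m" by (elim dvdE)
      then have "vabs (?g k) = vabs (of_nat (p * m) * f (x + k))"
        by (simp only: vabs_mult[of "of_nat (p * m)"] vabs_neg_one_power_mult)
      then show "vabs (?g k) \<le> B / real p" using p_multiple by simp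
    qed (use Bp in simp)
    moreover have "vabs (?g 0 + ?g n) \<le> B / real p"
    proof (cases "even n")
      case True
      then have "p = 2"
        using prime_p primes_dvd_imp_eq[of 2 p] by (simp add: n_def)
      then have "?g 0 + ?g n = (f (x + n) - f x) + of_nat (p * 1) * f x"
        using True by simp
      moreover have "max (vabs (f (x + n) - f x)) (vabs (of_nat (p * 1) * f x)) \<le> B / real p"
        using p_multiple[of 1 x] t[of x] unfolding n_def max.bounded_iff by blast
      ultimately show ?thesis
        using order_trans[OF vabs_add] by (simp only:)
    next
      case False
      then show ?thesis using t[of x] by (simp add: n_def)
    qed
    ultimately show ?thesis
      using vabs_add[of "\<Sum>k\<in>{..n} - {0, n}. ?g k" "?g 0 + ?g n"] by simp
  qed
  then show ?thesis by blast
qed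

text \<open>
  A bound reached once by some difference persists for all higher ones, so it suffices to iterate the contraction.
\<close>

lemma fdiff_funpow_tendsto_0:
  assumes f: "padic_uniform f" and B: "\<And>x. vabs (f x) \<le> B"
  shows "(\<lambda>n. (fdiff ^^ n) f 0) \<longlonglongrightarrow> 0"
proof -
  \<comment> \<open>The contraction step needs a positive bound.\<close>
  define C where "C = max B 1"
  have C: "C > 0" "\<And>x. vabs (f x) \<le> C"
    using B by (auto simp: C_def intro: max.coboundedI1)
  have contr: "\<exists>n. \<forall>x. vabs ((fdiff ^^ n) f x) \<le> C / real p ^ s" for s
  proof (induction s)
    case 0
    show ?case using C by (intro exI[of _ 0]) simp
  next
    case (Suc s)
    then obtain n where n: "\<And>x. vabs ((fdiff ^^ n) f x) \<le> C / real p ^ s" by blast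
    have "C / real p ^ s > 0" using C p_gt_1 by simp
    from fdiff_funpow_contracts[OF padic_uniform_fdiff_funpow[OF f] n this]
    obtain m where "\<And>x. vabs ((fdiff ^^ m) ((fdiff ^^ n) f) x) \<le> C / real p ^ s / real p" by blast
    then show ?case
      by (intro exI[of _ "m + n"]) (simp add: funpow_add mult.commute)
  qed
  show ?thesis
    unfolding lim_sequentially
  proof (intro allI impI)
    fix e :: real assume "e > 0"
    then obtain s where s: "(1 / real p) ^ s < e / C" using exists_p_power_less C by (metis divide_pos_pos)
    obtain n where n: "\<And>x. vabs ((fdiff ^^ n) f x) \<le> C / real p ^ s" using contr by blast
    have "dist ((fdiff ^^ m) f 0) 0 < e" if "m \<ge> n" for m
    proof -
      have "(fdiff ^^ m) f 0 = (fdiff ^^ (m - n)) ((fdiff ^^ n) f) 0"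
        using that by (simp flip: funpow_add[THEN fun_cong, unfolded comp_def])
      then have "dist ((fdiff ^^ m) f 0) 0 \<le> C / real p ^ s"
        using vabs_fdiff_funpow_le[of "(fdiff ^^ n) f", OF n] by (simp add: dist_vabs)
      also have "\<dots> < e" using s C p_gt_1 by (simp add: power_one_over field_simps)
      finally show ?thesis .
    qed
    then show "\<exists>N. \<forall>m\<ge>N. dist ((fdiff ^^ m) f 0) 0 < e" by blast
  qed
qed

text \<open>
  The coefficients are the finite differences at \<open>0\<close>. By Newton's formula the resulting continuous function
  agrees with \<open>\<phi>\<close> on the natural numbers, which are dense.
\<close>

lemma mahler:
  fixes \<phi> :: "'c \<Rightarrow> 'c"
  assumes \<phi>: "\<phi> \<in> C_Zp"
  shows "expands binom_fun (\<lambda>n. (fdiff ^^ n) (\<lambda>k. \<phi> (of_nat k)) 0) \<phi>"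
proof -
  define f where "f k = \<phi> (of_nat k)" for k
  define a where "a n = (fdiff ^^ n) f 0" for n
  define g where "g = (\<lambda>x\<in>Zp. \<Sum>n. a n * binom_fun n x)"
  have cont: "continuous_on Zp \<phi>"
    using \<phi> by (simp add: C_Zp_def)
  obtain B where B: "\<And>y. y \<in> Zp \<Longrightarrow> vabs (\<phi> y) \<le> B" using C_Zp_bounded[OF \<phi>] by blast
  have "padic_uniform f"
    unfolding padic_uniform_def
  proof (intro allI impI)
    fix e :: real assume e: "e > 0"
    have "uniformly_continuous_on Zp \<phi>"
      by (intro compact_uniformly_continuous compact_Zp cont)
    then obtain d where d: "d > 0" "\<And>x y. x \<in> Zp \<Longrightarrow> y \<in> Zp \<Longrightarrow> dist y x < d \<Longrightarrow> dist (\<phi> y) (\<phi> x) < e"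
      using e unfolding uniformly_continuous_on_def by meson
    obtain t where t: "(1 / real p) ^ t < d" using exists_p_power_less d by blast
    have "vabs (f (x + p ^ t) - f x) \<le> e" for x
    proof -
      have "dist (of_nat (x + p ^ t) :: 'c) (of_nat x) = vabs (of_nat (p ^ t * 1))"
        by (simp add: dist_vabs)
      then have "dist (of_nat (x + p ^ t) :: 'c) (of_nat x) < d"
        using vabs_p_power_mult_le[of t 1] t by linarith
      then show ?thesis
        unfolding f_def dist_vabs[symmetric] by (intro less_imp_le d(2) of_nat_in_Zp)
    qed
    then show "\<exists>t. \<forall>x. vabs (f (x + p ^ t) - f x) \<le> e" by blast
  qed
  then have "a \<longlonglongrightarrow> 0"
    unfolding a_def by (rule fdiff_funpow_tendsto_0[of f B]) (simp add: f_def B)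
  then have exp: "expands binom_fun a g"
    unfolding g_def by (intro expands_suminf vabs_binom_fun_le_1)
  have "g (of_nat k) = \<phi> (of_nat k)" for k
    using newton_forward[of f 0 k] by (simp add: expands_binom_of_nat[OF exp] a_def f_def)
  then have "g = \<phi>"
    using \<phi> expands_binom_continuous[OF exp] by (intro C_Zp_eqI) (auto simp: C_Zp_def g_def)
  then show ?thesis using exp unfolding a_def f_def by simp
qed

lemma expands_mahler_coeffs:
  fixes \<phi> :: "'c \<Rightarrow> 'c"
  assumes "\<phi> \<in> C_Zp" shows "expands binom_fun (mahler_coeffs \<phi>) \<phi>"
  unfolding mahler_coeffs_def
  by (rule theI[of "\<lambda>a. expands binom_fun a \<phi>", OF mahler[OF assms]])
    (rule expands_binom_unique[OF _ mahler[OF assms]])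

section \<open>Binomial convolution and the star product\<close>

text \<open>
  If \<open>n \<ge> M + N\<close> then \<open>k \<ge> M\<close> or \<open>n - k \<ge> N\<close>, so in every summand one factor is small while the other is bounded.
\<close>

lemma binomial_conv_tendsto_0:
  assumes a: "a \<longlonglongrightarrow> (0 :: 'c)" and b: "b \<longlonglongrightarrow> (0 :: 'c)"
  shows "binomial_conv a b \<longlonglongrightarrow> 0"
proof -
  have bound: "\<exists>B>0. \<forall>n. vabs (c n) \<le> B" if "c \<longlonglongrightarrow> 0" for c
  proof -
    have "bounded (range c)" using that by (intro convergent_imp_bounded)
    then obtain B where "\<And>n. vabs (c n) \<le> B"
      unfolding bounded_any_center[of _ 0] by (auto simp: dist_vabs)
    then show ?thesis by (intro exI[of _ "max B 1"]) (auto intro: max.coboundedI1)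
  qed
  obtain A where A: "A > 0" "\<And>n. vabs (a n) \<le> A" using bound[OF a] by blast
  obtain B where B: "B > 0" "\<And>n. vabs (b n) \<le> B" using bound[OF b] by blast
  show ?thesis
    unfolding lim_sequentially
  proof (intro allI impI)
    fix e :: real assume e: "e > 0"
    obtain M where M: "\<And>n. n \<ge> M \<Longrightarrow> vabs (a n) < e / 2 / B"
      using a e B(1) unfolding lim_sequentially dist_vabs by (metis diff_zero divide_pos_pos half_gt_zero)
    obtain N where N: "\<And>n. n \<ge> N \<Longrightarrow> vabs (b n) < e / 2 / A"
      using b e A(1) unfolding lim_sequentially dist_vabs by (metis diff_zero divide_pos_pos half_gt_zero)
    have "dist (binomial_conv a b n) 0 < e" if n: "n \<ge> M + N" for n
    proof -
      have "vabs (of_nat (n choose k) * a k * b (n - k)) \<le> e / 2" for k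
      proof -
        have "vabs (a k) * vabs (b (n - k)) \<le> e / 2"
        proof (cases "k \<ge> M")
          case True
          have "vabs (a k) * vabs (b (n - k)) \<le> (e / 2 / B) * B"
            using M[OF True] B e by (intro mult_mono) (auto intro: less_imp_le)
          then show ?thesis using B by simp
        next
          case False
          have "vabs (a k) * vabs (b (n - k)) \<le> A * (e / 2 / A)"
            using N[of "n - k"] False n A by (intro mult_mono) (auto intro: less_imp_le)
          then show ?thesis using A by simp
        qed
        moreover have "vabs (of_nat (n choose k)) * (vabs (a k) * vabs (b (n - k))) \<le>
            1 * (vabs (a k) * vabs (b (n - k)))"
          using vabs_of_nat_le_1 by (intro mult_right_mono) auto
        ultimately show ?thesis by (simp add: vabs_mult mult.assoc)
      qed
      then have "vabs (binomial_conv a b n) \<le> e / 2"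
        unfolding binomial_conv_def using e by (intro vabs_sum_le) auto
      then show ?thesis using e by (simp add: dist_vabs)
    qed
    then show "\<exists>N. \<forall>n\<ge>N. dist (binomial_conv a b n) 0 < e" by blast
  qed
qed

lemma binomial_conv_neg_one_power:
  "binomial_conv (\<lambda>n. (-1) ^ n * a n) (\<lambda>n. (-1) ^ n * b n) n = (-1) ^ n * (binomial_conv a b n :: 'c)"
  unfolding binomial_conv_def sum_distrib_left
proof (intro sum.cong refl)
  fix k assume "k \<in> {..n}"
  then have "(-1 :: 'c) ^ n = (-1) ^ k * (-1) ^ (n - k)" by (simp flip: power_add)
  then show "of_nat (n choose k) * ((- 1) ^ k * a k) * ((- 1) ^ (n - k) * b (n - k)) =
      (- 1) ^ n * (of_nat (n choose k) * a k * b (n - k))"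
    by (simp add: ac_simps)
qed

lemma expands_star:
  fixes \<phi> \<psi> :: "'c \<Rightarrow> 'c"
  assumes "\<phi> \<in> C_Zp" and "\<psi> \<in> C_Zp"
  shows "expands binom_fun (binomial_conv (mahler_coeffs \<phi>) (mahler_coeffs \<psi>)) (\<phi> \<star> \<psi>)"
  unfolding star_def
  using assms expands_mahler_coeffs
  by (intro expands_suminf vabs_binom_fun_le_1 binomial_conv_tendsto_0) (auto simp: expands_def)

lemma expands_binom_in_C_Zp: "expands binom_fun a f \<Longrightarrow> f \<in> extensional Zp \<Longrightarrow> f \<in> C_Zp"
  for f :: "'c \<Rightarrow> 'c"
  by (simp add: C_Zp_def expands_binom_continuous)

section \<open>The operators S and I\<close>

lemma expands_opI:
  assumes "\<phi> \<in> C_Zp"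
  shows "expands binom_fun (\<lambda>n. fact n * \<phi> (- 1 - of_nat n)) (opI \<phi> :: 'c \<Rightarrow> 'c)"
proof -
  obtain B where B: "\<And>x. x \<in> Zp \<Longrightarrow> vabs (\<phi> x) \<le> B" using C_Zp_bounded[OF assms] by blast
  have "(\<lambda>n. vabs (fact n)) \<longlonglongrightarrow> 0"
    using fact_tendsto_0 unfolding tendsto_vabs_iff[of _ 0] by simp
  then have "(\<lambda>n. vabs (fact n) * B) \<longlonglongrightarrow> 0" by (rule tendsto_mult_left_zero)
  then have "(\<lambda>n. fact n * \<phi> (- 1 - of_nat n)) \<longlonglongrightarrow> 0"
    by (rule tendsto_0_vabs_le) (simp add: vabs_mult B mult_left_mono)
  from expands_suminf[OF this vabs_binom_fun_le_1]
  have "expands binom_fun (\<lambda>n. fact n * \<phi> (- 1 - of_nat n))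
      (\<lambda>x\<in>Zp. \<Sum>n. fact n * \<phi> (- 1 - of_nat n) * binom_fun n x)" .
  also have "(\<lambda>x\<in>Zp. \<Sum>n. fact n * \<phi> (- 1 - of_nat n) * binom_fun n x) = opI \<phi>"
    unfolding opI_def by (rule restrict_ext) (simp add: binom_fun_def)
  finally show ?thesis .
qed

lemma opI_in_C_Zp: "\<phi> \<in> C_Zp \<Longrightarrow> (opI \<phi> :: 'c \<Rightarrow> 'c) \<in> C_Zp"
  by (rule expands_binom_in_C_Zp[OF expands_opI]) (simp_all add: opI_def)

lemma opI_sums:
  "\<phi> \<in> C_Zp \<Longrightarrow> s \<in> Zp \<Longrightarrow>
    (\<lambda>n. fact n * \<phi> (- 1 - of_nat n) * (s gchoose n)) sums (opI \<phi> s :: 'c)"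
  using expands_sums[OF expands_opI, of \<phi> s] by (simp add: binom_fun_def)

text \<open>
  Mahler coefficients are unique, so \<open>\<I>(\<phi>)\<close> determines \<open>n! \<phi>(-1 - n)\<close> for all \<open>n\<close>. After the reflection
  \<open>x \<mapsto> -1 - x\<close> of \<open>\<int>\<^sub>p\<close>, density of the natural numbers recovers \<open>\<phi>\<close>.
\<close>

lemma opI_inject:
  assumes \<phi>: "\<phi> \<in> C_Zp" and \<psi>: "\<psi> \<in> C_Zp" and eq: "opI \<phi> = (opI \<psi> :: 'c \<Rightarrow> 'c)"
  shows "\<phi> = \<psi>"
proof -
  have "(\<lambda>n. fact n * \<phi> (- 1 - of_nat n)) = (\<lambda>n. fact n * \<psi> (- 1 - of_nat n))"
    using expands_binom_unique expands_opI[OF \<phi>] expands_opI[OF \<psi>] eq by metis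
  then have neg: "\<phi> (- 1 - of_nat n) = \<psi> (- 1 - of_nat n)" for n
    by (metis fact_nonzero mult_left_cancel)
  have refl: "continuous_on Zp (\<lambda>x. \<xi> (- 1 - x))" if "\<xi> \<in> C_Zp" for \<xi> :: "'c \<Rightarrow> 'c"
  proof (rule continuous_on_compose2[of Zp \<xi>])
    show "continuous_on Zp (\<lambda>x::'c. - 1 - x)"
      unfolding continuous_on_def by (intro ballI tendsto_vabs_diff tendsto_const tendsto_ident_at)
    show "(\<lambda>x::'c. - 1 - x) ` Zp \<subseteq> Zp"
      using of_int_minus_in_Zp[of _ "-1"] by auto
  qed (use that in \<open>simp add: C_Zp_def\<close>)
  have "\<phi> x = \<psi> x" if "x \<in> Zp" for x
  proof -
    have "- 1 - x \<in> Zp" using of_int_minus_in_Zp[OF that, of "-1"] by simp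
    then have "\<phi> (- 1 - (- 1 - x)) = \<psi> (- 1 - (- 1 - x))"
      by (rule continuous_on_Zp_eqI[OF refl[OF \<phi>] refl[OF \<psi>] neg])
    then show ?thesis by simp
  qed
  then show ?thesis
    using \<phi> \<psi> by (intro extensionalityI[of \<phi> Zp \<psi>]) (auto simp: C_Zp_def)
qed

text \<open>
  A chosen preimage is the only one if \<open>\<S>\<close> is injective, and it is: \<open>\<S>(\<phi>)\<close> determines \<open>\<phi>(0)\<close>, since the term \<open>x \<phi>(x - 1)\<close> vanishes at \<open>0\<close>,
  then \<open>\<phi>(1), \<phi>(2), \<dots>\<close> recursively, and hence \<open>\<phi>\<close> by density.
\<close>

lemma opS_inv_eqI:
  assumes \<phi>: "\<phi> \<in> C_Zp" and "opS \<phi> = (\<xi> :: 'c \<Rightarrow> 'c)"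
  shows "opS_inv \<xi> = \<phi>"
proof -
  have "inj_on opS (C_Zp :: ('c \<Rightarrow> 'c) set)"
  proof (rule inj_onI)
    fix f g :: "'c \<Rightarrow> 'c" assume fg: "f \<in> C_Zp" "g \<in> C_Zp" and eq: "opS f = opS g"
    have step: "f x - x * f (x - 1) = g x - x * g (x - 1)" if "x \<in> Zp" for x
      using fun_cong[OF eq, of x] that by (simp add: opS_def)
    have "f (of_nat n) = g (of_nat n)" for n
    proof (induction n)
      case 0
      then show ?case using step[of 0] of_nat_in_Zp[of 0] by simp
    next
      case (Suc n)
      then show ?case using step[OF of_nat_in_Zp[of "Suc n"]] by simp
    qed
    then show "f = g" using fg by (intro C_Zp_eqI)
  qed
  then show ?thesis
    unfolding opS_inv_def using inv_into_f_f[OF _ \<phi>] assms(2) by blast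
qed

text \<open>
  Multiplication by \<open>s\<close> after the shift \<open>s \<mapsto> s - 1\<close> sends the \<open>n\<close>-th falling factorial to the next one, so \<open>\<S>\<close> acts on
  the coefficients \<open>\<phi>(-1 - n)\<close> as a backward difference. The value \<open>\<phi>(0)\<close> is a boundary term: the backward difference at
  \<open>n = 0\<close> would subtract it, but there is no coefficient before the first.
\<close>

lemma opS_opI:
  assumes \<phi>: "\<phi> \<in> C_Zp" and s: "s \<in> Zp"
  shows "opS (opI \<phi>) s = \<phi> 0 + (\<Sum>n. fact n * (\<phi> (- 1 - of_nat n) - \<phi> (- of_nat n)) * (s gchoose n) :: 'c)"
proof -
  define f where "f n = fact n * (s gchoose n)" for n
  have f0: "f 0 = 1" by (simp add: f_def)
  have f_Suc: "s * (fact n * ((s - 1) gchoose n)) = f (Suc n)" for n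
    using gbinomial_absorption[of n s] by (simp add: f_def ac_simps)
  \<comment> \<open>The series of \<open>s \<I>(\<phi>)(s - 1)\<close>, indexed so that its terms line up with those of \<open>\<I>(\<phi>)(s)\<close>.\<close>
  let ?T = "\<lambda>n. case n of 0 \<Rightarrow> 0 | Suc n \<Rightarrow> \<phi> (- 1 - of_nat n) * f (Suc n)"
  have "(\<lambda>n. s * (fact n * \<phi> (- 1 - of_nat n) * ((s - 1) gchoose n))) sums (s * opI \<phi> (s - 1))"
    by (intro sums_vabs_cmult opI_sums \<phi> diff_1_in_Zp s)
  then have "(\<lambda>n. ?T (Suc n)) sums (s * opI \<phi> (s - 1))"
    by (simp add: f_Suc[symmetric] ac_simps)
  then have "?T sums (s * opI \<phi> (s - 1))" using sums_vabs_Suc[of ?T] by simp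
  then have "(\<lambda>n. \<phi> (- 1 - of_nat n) * f n - ?T n) sums (opI \<phi> s - s * opI \<phi> (s - 1))"
    using opI_sums[OF \<phi> s] by (intro sums_vabs_diff) (auto simp: f_def ac_simps)
  moreover have "(\<lambda>n. if n = 0 then \<phi> 0 else 0) sums \<phi> 0"
    using sums_finite[of "{0}" "\<lambda>n. if n = 0 then \<phi> 0 else 0"] by simp
  ultimately have "(\<lambda>n. \<phi> (- 1 - of_nat n) * f n - ?T n - (if n = 0 then \<phi> 0 else 0)) sums
      (opI \<phi> s - s * opI \<phi> (s - 1) - \<phi> 0)"
    by (rule sums_vabs_diff)
  also have "(\<lambda>n. \<phi> (- 1 - of_nat n) * f n - ?T n - (if n = 0 then \<phi> 0 else 0)) =
      (\<lambda>n. fact n * (\<phi> (- 1 - of_nat n) - \<phi> (- of_nat n)) * (s gchoose n))"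
    by (auto simp: fun_eq_iff f0 f_def algebra_simps split: nat.split)
  finally show ?thesis
    using s by (simp add: opS_def sums_iff)
qed

section \<open>Expansions in the iterates of the inverse of S\<close>

definition signed_opI_binom :: "nat \<Rightarrow> 'c \<Rightarrow> 'c" where
  "signed_opI_binom m = (\<lambda>x\<in>Zp. (-1) ^ m * opI (binom_fun m) x)"

lemma continuous_on_cmult_Zp:
  fixes f :: "'c \<Rightarrow> 'c"
  shows "continuous_on Zp f \<Longrightarrow> continuous_on Zp (\<lambda>x. c * f x)"
  unfolding continuous_on_def by (auto intro: tendsto_vabs_mult)

lemma signed_opI_binom_in_C_Zp: "signed_opI_binom m \<in> C_Zp"
  using continuous_on_cmult_Zp[of "opI (binom_fun m)"] opI_in_C_Zp[OF binom_fun_in_C_Zp]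
  by (auto simp: C_Zp_def signed_opI_binom_def cong: continuous_on_cong)

lemma opS_signed_opI_binom_0: "opS (signed_opI_binom 0) = (\<lambda>x\<in>Zp. 1)"
proof
  fix s :: 'c
  show "opS (signed_opI_binom 0) s = (\<lambda>x\<in>Zp. 1) s"
  proof (cases "s \<in> Zp")
    case True
    have z: "- of_nat n \<in> (Zp :: 'c set)" for n using of_int_in_Zp[of "- int n"] by simp
    have "opS (signed_opI_binom 0) s = opS (opI (binom_fun 0)) s"
      using True diff_1_in_Zp by (simp add: opS_def signed_opI_binom_def)
    also have "\<dots> = 1"
      using z[of 0] unfolding opS_opI[OF binom_fun_in_C_Zp True] by (simp add: binom_fun_def z)
    finally show ?thesis using True by simp
  qed (simp add: opS_def)
qed

lemma opS_signed_opI_binom_Suc: "opS (signed_opI_binom (Suc m)) = signed_opI_binom m"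
proof
  fix s :: 'c
  show "opS (signed_opI_binom (Suc m)) s = signed_opI_binom m s"
  proof (cases "s \<in> Zp")
    case True
    have z: "- of_nat n \<in> (Zp :: 'c set)" for n using of_int_in_Zp[of "- int n"] by simp
    have pascal: "binom_fun (Suc m) (- 1 - of_nat n) - binom_fun (Suc m) (- of_nat n) =
        - binom_fun m (- 1 - of_nat n :: 'c)" for n
      using gbinomial_Suc_Suc[of "- 1 - of_nat n :: 'c" m] by (simp add: binom_fun_def z)
    have "opS (signed_opI_binom (Suc m)) s = (-1) ^ Suc m * opS (opI (binom_fun (Suc m))) s"
      using True diff_1_in_Zp by (simp add: opS_def signed_opI_binom_def algebra_simps)
    also have "opS (opI (binom_fun (Suc m))) s =
        (\<Sum>n. (-1) * (fact n * binom_fun m (- 1 - of_nat n) * (s gchoose n)))"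
      using z[of 0] by (simp add: opS_opI[OF binom_fun_in_C_Zp True] pascal) (simp add: binom_fun_def)
    also have "\<dots> = (-1) * opI (binom_fun m) s"
      using sums_vabs_cmult[OF opI_sums[OF binom_fun_in_C_Zp True, of m], of "-1"] by (simp only: sums_iff)
    finally have "opS (signed_opI_binom (Suc m)) s = (-1) ^ m * opI (binom_fun m) s" by simp
    then show ?thesis using True by (simp add: signed_opI_binom_def[of m])
  qed (simp add: opS_def signed_opI_binom_def)
qed

text \<open>
  Applying \<open>\<S>\<close> steps down the sequence \<open>(-1)\<^sup>m \<I>(\<beta>\<^sub>m)\<close> and ends at \<open>1 = \<S>(q)\<close>, so, \<open>\<S>\<close> being injective,
  it is the sequence \<open>\<S>\<^sup>-\<^sup>m(q)\<close>.
\<close>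

lemma Sq_fun_eq: "Sq_fun m = signed_opI_binom m"
proof (induction m)
  case 0
  show ?case
    unfolding Sq_fun_def q_fun_def
    using opS_inv_eqI[OF signed_opI_binom_in_C_Zp opS_signed_opI_binom_0] by simp
next
  case (Suc m)
  then show ?case
    using opS_inv_eqI[OF signed_opI_binom_in_C_Zp opS_signed_opI_binom_Suc] by (simp add: Sq_fun_def)
qed

lemma opI_sum:
  assumes s: "s \<in> Zp"
  shows "opI (\<lambda>x\<in>Zp. \<Sum>m<M. a m * binom_fun m x) s = (\<Sum>m<M. a m * opI (binom_fun m) s :: 'c)"
proof -
  have "(\<lambda>n. \<Sum>m<M. a m * (fact n * binom_fun m (- 1 - of_nat n) * (s gchoose n))) sums
      (\<Sum>m<M. a m * opI (binom_fun m) s)"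
    by (intro sums_vabs_sum sums_vabs_cmult opI_sums binom_fun_in_C_Zp s)
  then have "(\<lambda>n. fact n * (\<Sum>m<M. a m * binom_fun m (- 1 - of_nat n)) * (s gchoose n)) sums
      (\<Sum>m<M. a m * opI (binom_fun m) s)"
    by (simp add: sum_distrib_left sum_distrib_right ac_simps)
  then show ?thesis using s by (simp add: opI_def sums_iff)
qed

text \<open>
  The factors \<open>n! binom(s, n)\<close> lie in the unit ball.
\<close>

lemma opI_nonexpansive:
  assumes "\<phi> \<in> C_Zp" and "\<psi> \<in> C_Zp" and s: "s \<in> Zp"
    and le: "\<And>x. x \<in> Zp \<Longrightarrow> vabs (\<phi> x - \<psi> x) \<le> e" and e: "e \<ge> 0"
  shows "vabs (opI \<phi> s - opI \<psi> s) \<le> e"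
proof (rule lim_vabs_diff_le)
  show "(\<lambda>N. \<Sum>n<N. fact n * \<phi> (- 1 - of_nat n) * (s gchoose n)) \<longlonglongrightarrow> opI \<phi> s"
    "(\<lambda>N. \<Sum>n<N. fact n * \<psi> (- 1 - of_nat n) * (s gchoose n)) \<longlonglongrightarrow> opI \<psi> s"
    using opI_sums assms by (auto simp: sums_def)
  fix N
  have "vabs (fact n * \<phi> (- 1 - of_nat n) * (s gchoose n) - fact n * \<psi> (- 1 - of_nat n) * (s gchoose n)) \<le> e" for n
  proof -
    have "fact n * \<phi> (- 1 - of_nat n) * (s gchoose n) - fact n * \<psi> (- 1 - of_nat n) * (s gchoose n) =
        (of_nat (fact n) * (s gchoose n)) * (\<phi> (- 1 - of_nat n) - \<psi> (- 1 - of_nat n))"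
      by (simp add: algebra_simps)
    moreover have "vabs (of_nat (fact n) * (s gchoose n)) \<le> 1"
      unfolding vabs_mult by (intro mult_le_one vabs_of_nat_le_1 vabs_gchoose_le_1 s vabs_nonneg)
    ultimately show ?thesis
      using le[OF minus_1_minus_of_nat_in_Zp[of n]] mult_mono[of "vabs (of_nat (fact n) * (s gchoose n))" 1] vabs_nonneg
      by (metis mult_1 vabs_mult zero_le_one)
  qed
  then show "vabs ((\<Sum>n<N. fact n * \<phi> (- 1 - of_nat n) * (s gchoose n)) -
      (\<Sum>n<N. fact n * \<psi> (- 1 - of_nat n) * (s gchoose n))) \<le> e"
    unfolding sum_subtractf[symmetric] using e by (intro vabs_sum_le)
qed

text \<open>
  A partial sum of the target series is \<open>\<I>\<close> of the corresponding Mahler partial sum, and \<open>\<I>\<close> preserves uniform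
  closeness.
\<close>

lemma expands_Sq_opI:
  assumes exp: "expands binom_fun a \<phi>" and \<phi>: "\<phi> \<in> C_Zp"
  shows "expands Sq_fun (\<lambda>n. (-1) ^ n * a n) (opI \<phi> :: 'c \<Rightarrow> 'c)"
  unfolding expands_def
proof (intro conjI uniform_limitI)
  show "(\<lambda>n. (-1) ^ n * a n) \<longlonglongrightarrow> 0"
    using exp unfolding expands_def tendsto_vabs_iff[of _ 0] by simp
  fix e :: real assume e: "e > 0"
  let ?P = "\<lambda>M. \<lambda>x\<in>Zp. \<Sum>m<M. a m * binom_fun m x"
  have P: "?P M \<in> C_Zp" for M
    using continuous_on_sum_Zp[of M binom_fun a] binom_fun_in_C_Zp
    by (auto simp: C_Zp_def cong: continuous_on_cong)
  have S: "(\<Sum>m<M. (-1) ^ m * a m * Sq_fun m s) = opI (?P M) s" if "s \<in> Zp" for M s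
  proof -
    have "(-1) ^ m * a m * ((-1) ^ m * t) = a m * t" for m and t :: 'c
      by (simp add: mult.assoc mult.left_commute flip: power_add)
    then show ?thesis using that by (simp only: opI_sum Sq_fun_eq signed_opI_binom_def restrict_apply' if_True)
  qed
  have "\<forall>\<^sub>F M in sequentially. \<forall>x\<in>Zp. dist (\<Sum>m<M. a m * binom_fun m x) (\<phi> x) < e / 2"
    using exp e unfolding expands_def by (auto dest!: uniform_limitD[of _ _ _ _ "e / 2"])
  then show "\<forall>\<^sub>F M in sequentially. \<forall>s\<in>Zp. dist (\<Sum>m<M. (-1) ^ m * a m * Sq_fun m s) (opI \<phi> s) < e"
  proof eventually_elim
    case (elim M)
    show ?case
    proof
      fix s :: 'c assume s: "s \<in> Zp"
      have "vabs (opI (?P M) s - opI \<phi> s) \<le> e / 2"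
        using elim e by (intro opI_nonexpansive P \<phi> s) (auto simp: dist_vabs intro: less_imp_le)
      then show "dist (\<Sum>m<M. (-1) ^ m * a m * Sq_fun m s) (opI \<phi> s) < e"
        using e by (simp add: S[OF s] dist_vabs)
    qed
  qed
qed

text \<open>
  Any coefficients \<open>d\<^sub>n\<close> of \<open>f\<close> come from a function \<open>\<Sum> (-1)\<^sup>n d\<^sub>n \<beta>\<^sub>n\<close> that \<open>\<I>\<close> maps to \<open>f\<close>. As \<open>\<I>\<close> is
  injective, there is only one such function, and its Mahler coefficients are unique.
\<close>

lemma expands_Sq_unique:
  assumes b: "expands Sq_fun b f" and c: "expands Sq_fun c f" and f: "(f :: 'c \<Rightarrow> 'c) \<in> extensional Zp"
  shows "b = c"
proof -
  have *: "\<exists>\<phi>\<in>C_Zp. opI \<phi> = f \<and> expands binom_fun (\<lambda>n. (-1) ^ n * d n) \<phi>" if d: "expands Sq_fun d f" for d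
  proof -
    define \<phi> where "\<phi> = (\<lambda>x\<in>Zp. \<Sum>n. (-1) ^ n * d n * binom_fun n (x :: 'c))"
    have "(\<lambda>n. (-1) ^ n * d n) \<longlonglongrightarrow> 0"
      using d unfolding expands_def tendsto_vabs_iff[of _ 0] by simp
    then have exp: "expands binom_fun (\<lambda>n. (-1) ^ n * d n) \<phi>"
      unfolding \<phi>_def by (intro expands_suminf vabs_binom_fun_le_1)
    then have \<phi>: "\<phi> \<in> C_Zp" by (rule expands_binom_in_C_Zp) (simp add: \<phi>_def)
    have "expands Sq_fun d (opI \<phi>)"
      using expands_Sq_opI[OF exp \<phi>] by (simp flip: mult.assoc power_mult_distrib)
    then have "opI \<phi> = f"
      using expands_eq_suminf[OF d f] expands_eq_suminf[of Sq_fun d "opI \<phi>"] by (simp add: opI_def)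
    then show ?thesis using exp \<phi> by blast
  qed
  obtain \<phi> \<psi> where "\<phi> \<in> C_Zp" "opI \<phi> = f" "expands binom_fun (\<lambda>n. (-1) ^ n * b n) \<phi>"
    "\<psi> \<in> C_Zp" "opI \<psi> = f" "expands binom_fun (\<lambda>n. (-1) ^ n * c n) \<psi>"
    using *[OF b] *[OF c] by blast
  then have "(\<lambda>n. (-1) ^ n * b n) = (\<lambda>n. (-1) ^ n * c n)"
    using opI_inject[of \<phi> \<psi>] expands_binom_unique by metis
  then show ?thesis by (simp add: fun_eq_iff)
qed

lemma Sq_coeffs_opI:
  assumes \<phi>: "\<phi> \<in> C_Zp"
  shows "Sq_coeffs (opI \<phi> :: 'c \<Rightarrow> 'c) = (\<lambda>n. (-1) ^ n * mahler_coeffs \<phi> n)"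
  unfolding Sq_coeffs_def
proof (rule the_equality)
  show exp: "expands Sq_fun (\<lambda>n. (-1) ^ n * mahler_coeffs \<phi> n) (opI \<phi>)"
    using expands_Sq_opI[OF expands_mahler_coeffs[OF \<phi>] \<phi>] .
  show "b = (\<lambda>n. (-1) ^ n * mahler_coeffs \<phi> n)" if "expands Sq_fun b (opI \<phi>)" for b
    using expands_Sq_unique[OF that exp] by (simp add: opI_def)
qed

end

theorem proposition6p19:
  fixes p :: nat
    and vabs :: "'c::{field_char_0, complete_space} \<Rightarrow> real"
    and \<phi> \<psi> :: "'c \<Rightarrow> 'c"
  assumes "padic_complex_field p vabs"
    and "\<phi> \<in> C_Zp" and "\<psi> \<in> C_Zp"
  shows "opI (\<phi> \<star> \<psi>) = opI \<phi> \<diamondop> opI \<psi>"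
proof -
  interpret padic_complex_field p vabs by fact
  let ?c = "binomial_conv (mahler_coeffs \<phi>) (mahler_coeffs \<psi>)"
  have exp: "expands binom_fun ?c (\<phi> \<star> \<psi>)" using expands_star assms(2,3) .
  then have "\<phi> \<star> \<psi> \<in> C_Zp" by (rule expands_binom_in_C_Zp) (simp add: star_def)
  then have "expands Sq_fun (\<lambda>n. (-1) ^ n * ?c n) (opI (\<phi> \<star> \<psi>))"
    using expands_Sq_opI exp by blast
  then have "opI (\<phi> \<star> \<psi>) = (\<lambda>x\<in>Zp. \<Sum>n. (-1) ^ n * ?c n * Sq_fun n x)"
    by (rule expands_eq_suminf) (simp add: opI_def)
  then show ?thesis
    unfolding diamond_def Sq_coeffs_opI[OF assms(2)] Sq_coeffs_opI[OF assms(3)]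
      binomial_conv_neg_one_power .
qed

end
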